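(* Let $P$ and $P'$ be two polymatroids on the same ground set $[n]$. If $P'\subset P$, then $I_{P'}\le I_P$ and $X_{P'}\le X_P$ coefficientwise.
   Context: A polymatroid on $[n]$ is $P=\{\mathbf a\in\mathbb{Z}^n\mid \sum_{i\in I}a_i\le f(I)\ \forall I\subset[n],\ \sum_{i\in[n]}a_i=f([n])\}$ with $f:2^{[n]}\to\mathbb{Z}$, $f(\emptyset)=0$, $f$ submodular. For $\mathbf a\in P$, $i$ is internally active if $\mathbf a-\mathbf e_i+\mathbf e_j\notin P$ for all $j<i$, externally active if $\mathbf a+\mathbf e_i-\mathbf e_j\notin P$ for all $j<i$; $\mathrm{Int}(\mathbf a),\mathrm{Ext}(\mathbf a)$ denote these sets. $I_P(x)=\sum_{\mathbf a\in P}x^{n-|\mathrm{Int}(\mathbf a)|}$, $X_P(y)=\sum_{\mathbf a\in P}y^{n-|\mathrm{Ext}(\mathbf a)|}$. For polynomials, $g_1\le g_2$ means every coefficient of $g_1$ is at most the corresponding coefficient of $g_2$. *)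

theory Defs
  imports "HOL-Computational_Algebra.Polynomial" "HOL-Library.Function_Algebras"
begin

text \<open>Vectors indexed by \<open>[n] = {1..n}\<close> are functions \<open>nat \<Rightarrow> int\<close> that vanish outside \<open>{1..n}\<close>, so
  that distinct functions are distinct vectors; sums and differences are pointwise.\<close>

definition lattice_vectors :: "nat \<Rightarrow> (nat \<Rightarrow> int) set" where
  "lattice_vectors n = {a. \<forall>i. i \<notin> {1..n} \<longrightarrow> a i = 0}"

definition unit_vector :: "nat \<Rightarrow> nat \<Rightarrow> int" where
  "unit_vector i = (\<lambda>k. if k = i then 1 else 0)"

definition submodular_on :: "'a set \<Rightarrow> ('a set \<Rightarrow> int) \<Rightarrow> bool" where
  "submodular_on E f \<longleftrightarrow>
     (\<forall>I J. I \<subseteq> E \<longrightarrow> J \<subseteq> E \<longrightarrow> f (I \<union> J) + f (I \<inter> J) \<le> f I + f J)"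

text \<open>No monotonicity or nonnegativity of \<open>f\<close> is required.\<close>

definition polymatroid_of :: "nat \<Rightarrow> (nat set \<Rightarrow> int) \<Rightarrow> (nat \<Rightarrow> int) set" where
  "polymatroid_of n f =
     {a \<in> lattice_vectors n.
        (\<forall>I. I \<subseteq> {1..n} \<longrightarrow> (\<Sum>i\<in>I. a i) \<le> f I) \<and> (\<Sum>i\<in>{1..n}. a i) = f {1..n}}"

definition polymatroid :: "nat \<Rightarrow> (nat \<Rightarrow> int) set \<Rightarrow> bool" where
  "polymatroid n P \<longleftrightarrow>
     (\<exists>f. f {} = 0 \<and> submodular_on {1..n} f \<and> P = polymatroid_of n f)"

definition internally_active :: "nat \<Rightarrow> (nat \<Rightarrow> int) set \<Rightarrow> (nat \<Rightarrow> int) \<Rightarrow> nat set" where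
  "internally_active n P a =
     {i \<in> {1..n}. \<forall>j\<in>{1..n}. j < i \<longrightarrow> a - unit_vector i + unit_vector j \<notin> P}"

definition externally_active :: "nat \<Rightarrow> (nat \<Rightarrow> int) set \<Rightarrow> (nat \<Rightarrow> int) \<Rightarrow> nat set" where
  "externally_active n P a =
     {i \<in> {1..n}. \<forall>j\<in>{1..n}. j < i \<longrightarrow> a + unit_vector i - unit_vector j \<notin> P}"

text \<open>The sums below range over finite sets by \<open>finite_polymatroid\<close>, and the natural-number
  subtraction never truncates, since the active sets are subsets of \<open>{1..n}\<close>.\<close>

definition interior_poly :: "nat \<Rightarrow> (nat \<Rightarrow> int) set \<Rightarrow> int poly" where
  "interior_poly n P = (\<Sum>a\<in>P. monom 1 (n - card (internally_active n P a)))"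

definition exterior_poly :: "nat \<Rightarrow> (nat \<Rightarrow> int) set \<Rightarrow> int poly" where
  "exterior_poly n P = (\<Sum>a\<in>P. monom 1 (n - card (externally_active n P a)))"

text \<open>The library's order on \<open>int poly\<close> looks only at the sign of the leading coefficient of the
  difference, hence a separate relation.\<close>

definition coeffwise_le :: "int poly \<Rightarrow> int poly \<Rightarrow> bool" where
  "coeffwise_le g h \<longleftrightarrow> (\<forall>k. coeff g k \<le> coeff h k)"

lemma finite_polymatroid_of: "finite (polymatroid_of n f)"
proof -
  define B where "B = (\<Sum>i\<in>{1..n}. \<bar>f {i}\<bar> + \<bar>f ({1..n} - {i})\<bar>) + \<bar>f {1..n}\<bar>"
  have "a i \<in> {-B..B}" if a: "a \<in> polymatroid_of n f" and i: "i \<in> {1..n}" for a i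
  proof -
    have le: "(\<Sum>i\<in>I. a i) \<le> f I" if "I \<subseteq> {1..n}" for I
      using a that by (simp add: polymatroid_of_def)
    have up: "a i \<le> f {i}"
      using le[of "{i}"] i by simp
    have "(\<Sum>i\<in>{1..n}. a i) = a i + (\<Sum>i\<in>{1..n} - {i}. a i)"
      using i by (simp add: sum.remove)
    moreover have "(\<Sum>i\<in>{1..n}. a i) = f {1..n}"
      using a by (simp add: polymatroid_of_def)
    moreover have "(\<Sum>i\<in>{1..n} - {i}. a i) \<le> f ({1..n} - {i})"
      by (rule le) auto
    ultimately have lo: "f {1..n} - f ({1..n} - {i}) \<le> a i" by linarith
    have "\<bar>f {i}\<bar> + \<bar>f ({1..n} - {i})\<bar> \<le> (\<Sum>i\<in>{1..n}. \<bar>f {i}\<bar> + \<bar>f ({1..n} - {i})\<bar>)"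
      using i by (intro member_le_sum) auto
    then show ?thesis using up lo unfolding B_def by auto
  qed
  then have "polymatroid_of n f \<subseteq>
      {a. \<forall>i. (i \<in> {1..n} \<longrightarrow> a i \<in> {-B..B}) \<and> (i \<notin> {1..n} \<longrightarrow> a i = 0)}"
    by (auto simp: polymatroid_of_def lattice_vectors_def)
  moreover have "finite {a. \<forall>i. (i \<in> {1..n} \<longrightarrow> a i \<in> {-B..B}) \<and> (i \<notin> {1..n} \<longrightarrow> a i = 0)}"
    by (rule finite_set_of_finite_funs) auto
  ultimately show ?thesis by (rule finite_subset)
qed

lemma finite_polymatroid: "polymatroid n P \<Longrightarrow> finite P"
  by (auto simp: polymatroid_def finite_polymatroid_of)

end

theory Submission
  imports Defs
begin

text \<open>Replacing \<open>P\<close> by \<open>-P\<close> exchanges the two polynomials, so it suffices to treat \<open>X\<close>. Slicing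
  \<open>P\<close> by its last coordinate, the index \<open>n\<close> is externally active exactly on the top slice, so
  \<open>X\<^bsub>P\<^esub> = X\<^bsub>P\<^sub>M\<^esub> + y \<Sum>\<^sub>k\<^sub><\<^sub>M X\<^bsub>P\<^sub>k\<^esub>\<close>, where \<open>M\<close> is the largest
  value of the coordinate. If \<open>P' \<subseteq> P\<close> has a smaller top slice, then induction on \<open>n\<close> compares
  \<open>P'\<close> only with a truncation of \<open>P\<close>, and passing from a truncation to the next one requires
  \<open>(1 - y) X\<^bsub>P\<^sub>k\<^esub> \<le> X\<^bsub>P\<^sub>k\<^sub>+\<^sub>1\<^esub>\<close> for adjacent nonempty slices. This follows by slicing
  both sides once more: their ranges in the next coordinate have tops that agree or differ by one,
  and in the latter case the two top slices are translates of each other.\<close>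

section \<open>Exchange\<close>

text \<open>One-sided exchange axiom for the integer points of a base polytope. Coordinates outside
  \<open>S\<close> are constant rather than zero, so a slice is an object on a smaller ground set
  without any change to its vectors.\<close>

definition M_convex :: "nat set \<Rightarrow> (nat \<Rightarrow> int) set \<Rightarrow> bool" where
  "M_convex S P \<longleftrightarrow> finite P \<and>
     (\<forall>a\<in>P. \<forall>b\<in>P. (\<forall>i. i \<notin> S \<longrightarrow> a i = b i) \<and>
        (\<forall>i. a i < b i \<longrightarrow> (\<exists>j. b j < a j \<and> a + unit_vector i - unit_vector j \<in> P)))"

definition slice :: "nat \<Rightarrow> int \<Rightarrow> (nat \<Rightarrow> int) set \<Rightarrow> (nat \<Rightarrow> int) set" where
  "slice p k P = {a \<in> P. a p = k}"

lemma slice_iff: "a \<in> slice p k P \<longleftrightarrow> a \<in> P \<and> a p = k"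
  by (simp add: slice_def)

lemma slice_commute: "slice p k (slice q l P) = slice q l (slice p k P)"
  by (auto simp: slice_def)

lemma unit_vector_apply: "unit_vector i k = (if k = i then 1 else 0)"
  by (simp add: unit_vector_def)

lemma M_convex_finite: "M_convex S P \<Longrightarrow> finite P"
  by (simp add: M_convex_def)

lemma M_convex_agree: "M_convex S P \<Longrightarrow> a \<in> P \<Longrightarrow> b \<in> P \<Longrightarrow> i \<notin> S \<Longrightarrow> a i = b i"
  unfolding M_convex_def by blast

lemma M_convex_exchange:
  assumes "M_convex S P" "a \<in> P" "b \<in> P" "a i < b i"
  obtains j where "b j < a j" "j \<in> S" "j \<noteq> i" "a + unit_vector i - unit_vector j \<in> P"
proof -
  obtain j where "b j < a j" "a + unit_vector i - unit_vector j \<in> P"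
    using assms unfolding M_convex_def by blast
  moreover have "j \<in> S"
    using M_convex_agree[OF assms(1-3), of j] calculation by force
  ultimately show ?thesis using assms(4) by (intro that[of j]) auto
qed

text \<open>Points of a slice agree at \<open>p\<close>, so neither the raised nor the lowered
  coordinate of an exchange between them can be \<open>p\<close>.\<close>

lemma M_convex_slice:
  assumes "M_convex (insert p S) P"
  shows "M_convex S (slice p k P)"
  unfolding M_convex_def
proof (intro conjI ballI allI impI)
  show "finite (slice p k P)"
    using M_convex_finite[OF assms] by (simp add: slice_def)
next
  fix a b i assume "a \<in> slice p k P" "b \<in> slice p k P" "i \<notin> S"
  then show "a i = b i"
    using M_convex_agree[OF assms, of a b i] by (cases "i = p") (auto simp: slice_iff)
next
  fix a b i assume ab: "a \<in> slice p k P" "b \<in> slice p k P" "a i < b i"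
  then obtain j where j: "b j < a j" "a + unit_vector i - unit_vector j \<in> P"
    using M_convex_exchange[OF assms, of a b i] by (auto simp: slice_iff)
  have "i \<noteq> p" "j \<noteq> p" using ab j by (auto simp: slice_iff)
  then have "a + unit_vector i - unit_vector j \<in> slice p k P"
    using ab j by (simp add: slice_iff unit_vector_apply)
  then show "\<exists>j. b j < a j \<and> a + unit_vector i - unit_vector j \<in> slice p k P"
    using j by blast
qed

lemma finite_int_max:
  fixes f :: "'a \<Rightarrow> int"
  assumes "finite A" "A \<noteq> {}"
  obtains a where "a \<in> A" "\<And>b. b \<in> A \<Longrightarrow> f b \<le> f a"
proof -
  have "Max (f ` A) \<in> f ` A" using assms by simp
  then obtain a where a: "a \<in> A" "f a = Max (f ` A)" by auto
  have "f b \<le> f a" if "b \<in> A" for b using assms(1) that by (simp add: a(2))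
  with a(1) show ?thesis by (rule that)
qed

lemma finite_int_lower:
  fixes f :: "'a \<Rightarrow> int"
  assumes "finite A"
  obtains l where "\<And>b. b \<in> A \<Longrightarrow> l \<le> f b" "l \<le> u"
  using assms
proof -
  let ?l = "Min (insert u (f ` A))"
  have "?l \<le> f b" if "b \<in> A" for b using that assms by simp
  moreover have "?l \<le> u" using assms by simp
  ultimately show ?thesis using that by blast
qed

section \<open>Counting points by external inactivity\<close>

text \<open>Complement of the externally active set, so its size is the exponent in X. Only the
  first \<open>m\<close> coordinates are tested, since on a slice the later ones are fixed.\<close>

definition inactive :: "nat \<Rightarrow> (nat \<Rightarrow> int) set \<Rightarrow> (nat \<Rightarrow> int) \<Rightarrow> nat set" where
  "inactive m P a = {i \<in> {1..m}. \<exists>j\<in>{1..m}. j < i \<and> a + unit_vector i - unit_vector j \<in> P}"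

text \<open>The degree is an integer, so that the shift \<open>d - 1\<close> does not truncate.\<close>

definition ext_count :: "nat \<Rightarrow> (nat \<Rightarrow> int) set \<Rightarrow> int \<Rightarrow> int" where
  "ext_count m P d = int (card {a \<in> P. int (card (inactive m P a)) = d})"

lemma finite_inactive: "finite (inactive m P a)"
  by (simp add: inactive_def)

lemma ext_count_empty: "ext_count m {} d = 0"
  by (simp add: ext_count_def)

lemma ext_count_nonneg: "0 \<le> ext_count m P d"
  by (simp add: ext_count_def)

lemma ext_count_0: "ext_count 0 P d = (if d = 0 then int (card P) else 0)"
  by (auto simp: ext_count_def inactive_def)

lemma ext_count_translate: "ext_count m ((\<lambda>a. a + v) ` P) d = ext_count m P d"
proof -
  have mem: "a + v + unit_vector i - unit_vector j \<in> (\<lambda>a. a + v) ` P \<longleftrightarrow>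
      a + unit_vector i - unit_vector j \<in> P" for a i j
  proof -
    have "a + v + unit_vector i - unit_vector j = (a + unit_vector i - unit_vector j) + v"
      by (simp add: algebra_simps)
    then show ?thesis by (auto simp only: inj_image_mem_iff[of "\<lambda>a. a + v"] inj_on_def add_right_cancel)
  qed
  have eq: "inactive m ((\<lambda>a. a + v) ` P) (a + v) = inactive m P a" for a
    by (simp only: inactive_def mem)
  have "{a \<in> (\<lambda>a. a + v) ` P. int (card (inactive m ((\<lambda>a. a + v) ` P) a)) = d}
      = (\<lambda>a. a + v) ` {a \<in> P. int (card (inactive m P a)) = d}"
    by (auto simp: eq)
  then show ?thesis
    by (simp add: ext_count_def card_image inj_on_def)
qed

text \<open>A move at \<open>i \<le> m\<close> lowers some \<open>j < i\<close>, so it keeps the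
  last coordinate and stays in the slice. A move at \<open>Suc m\<close> raises that coordinate:
  impossible at the top, while below it the exchange towards \<open>z\<close> provides one, every
  other index being smaller.\<close>

lemma inactive_Suc:
  assumes P: "M_convex {1..Suc m} P" and a: "a \<in> P" and z: "z \<in> P"
    and top: "\<And>b. b \<in> P \<Longrightarrow> b (Suc m) \<le> z (Suc m)"
  shows "inactive (Suc m) P a = inactive m (slice (Suc m) (a (Suc m)) P) a \<union>
     (if a (Suc m) < z (Suc m) then {Suc m} else {})"
proof -
  have low: "i \<in> inactive (Suc m) P a \<longleftrightarrow> i \<in> inactive m (slice (Suc m) (a (Suc m)) P) a"
    if "i \<le> m" for i
    using that by (fastforce simp: inactive_def slice_iff unit_vector_apply)
  have "Suc m \<in> inactive (Suc m) P a \<longleftrightarrow> a (Suc m) < z (Suc m)"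
  proof
    assume "Suc m \<in> inactive (Suc m) P a"
    then obtain j where "j < Suc m" "a + unit_vector (Suc m) - unit_vector j \<in> P"
      by (auto simp: inactive_def)
    with top[of "a + unit_vector (Suc m) - unit_vector j"] show "a (Suc m) < z (Suc m)"
      by (simp add: unit_vector_apply)
  next
    assume "a (Suc m) < z (Suc m)"
    then obtain j where "j \<in> {1..Suc m}" "j \<noteq> Suc m"
        "a + unit_vector (Suc m) - unit_vector j \<in> P"
      using M_convex_exchange[OF P a z] by blast
    then show "Suc m \<in> inactive (Suc m) P a"
      unfolding inactive_def by (auto intro!: bexI[of _ j])
  qed
  moreover have "inactive (Suc m) P a \<subseteq> {..Suc m}"
      "inactive m (slice (Suc m) (a (Suc m)) P) a \<subseteq> {..m}"
    by (auto simp: inactive_def)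
  ultimately show ?thesis
    using low by (intro set_eqI) (auto, (metis atMost_iff le_SucE subsetD)+)
qed

text \<open>Exactly the points below the top gain the inactive index \<open>Suc m\<close>, which
  raises their degree by one. Slices below the minimum are empty, so any lower bound
  \<open>l\<close> may start the sum; this lets two sets share one range.\<close>

lemma ext_count_Suc:
  assumes P: "M_convex {1..Suc m} P" and z: "z \<in> P"
    and top: "\<And>b. b \<in> P \<Longrightarrow> b (Suc m) \<le> z (Suc m)"
    and low: "\<And>b. b \<in> P \<Longrightarrow> l \<le> b (Suc m)"
  shows "ext_count (Suc m) P d = ext_count m (slice (Suc m) (z (Suc m)) P) d +
     (\<Sum>k\<in>{l..<z (Suc m)}. ext_count m (slice (Suc m) k P) (d - 1))"
proof -
  define C where "C k e =
    {a \<in> slice (Suc m) k P. int (card (inactive m (slice (Suc m) k P) a)) = e}" for k e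
  have fin: "finite (C k e)" for k e
    using M_convex_finite[OF P] by (simp add: C_def slice_def)
  have deg: "int (card (inactive (Suc m) P a)) =
      int (card (inactive m (slice (Suc m) (a (Suc m)) P) a)) +
      (if a (Suc m) < z (Suc m) then 1 else 0)" if "a \<in> P" for a
  proof -
    have "Suc m \<notin> inactive m (slice (Suc m) (a (Suc m)) P) a"
      by (simp add: inactive_def)
    then show ?thesis
      using inactive_Suc[OF P that z] top by (simp add: finite_inactive)
  qed
  have "{a \<in> P. int (card (inactive (Suc m) P a)) = d} =
      C (z (Suc m)) d \<union> (\<Union>k\<in>{l..<z (Suc m)}. C k (d - 1))"
  proof (intro set_eqI)
    fix a
    show "a \<in> {a \<in> P. int (card (inactive (Suc m) P a)) = d} \<longleftrightarrow>
        a \<in> C (z (Suc m)) d \<union> (\<Union>k\<in>{l..<z (Suc m)}. C k (d - 1))"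
    proof (cases "a \<in> P")
      case True
      then show ?thesis
        using top[OF True] low[OF True] by (auto simp: C_def slice_iff deg[OF True])
    next
      case False
      then show ?thesis by (simp add: C_def slice_iff)
    qed
  qed
  moreover have "C (z (Suc m)) d \<inter> (\<Union>k\<in>{l..<z (Suc m)}. C k (d - 1)) = {}"
    by (auto simp: C_def slice_iff)
  moreover have "card (\<Union>k\<in>{l..<z (Suc m)}. C k (d - 1)) =
      (\<Sum>k\<in>{l..<z (Suc m)}. card (C k (d - 1)))"
    by (intro card_UN_disjoint) (auto simp: fin, auto simp: C_def slice_iff)
  ultimately show ?thesis
    by (simp add: ext_count_def card_Un_disjoint fin C_def[symmetric])
qed

section \<open>Adjacent slices and monotonicity\<close>

text \<open>The index \<open>p\<close> is arbitrary above \<open>m\<close> because the induction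
  peels off coordinate \<open>Suc m\<close> while keeping \<open>p\<close>. The induction hypothesis
  is used in two ways: for \<open>p\<close> inside a slice at \<open>q\<close>, and for
  \<open>q\<close> inside \<open>A\<close>.\<close>

lemma ext_count_adjacent:
  assumes "M_convex (insert p {1..m}) P" "m < p"
    and "slice p k P \<noteq> {}" "slice p (k + 1) P \<noteq> {}"
  shows "ext_count m (slice p k P) d \<le> ext_count m (slice p (k + 1) P) d
     + ext_count m (slice p k P) (d - 1)"
  using assms
proof (induction m arbitrary: p P k d)
  case 0
  \<comment> \<open>All coordinates are fixed here, so the slice has at most one point, of degree 0,
    and one point in the next slice suffices.\<close>
  have "card (slice p k P) \<le> 1"
  proof (rule card_le_Suc0_iff_eq[THEN iffD2, folded One_nat_def])
    show fin: "finite (slice p k P)"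
      using M_convex_finite[OF 0(1)] by (simp add: slice_def)
    show "\<forall>x\<in>slice p k P. \<forall>y\<in>slice p k P. x = y"
      using M_convex_agree[OF M_convex_slice[OF 0(1)]] by fastforce
  qed
  moreover have "0 < card (slice p (k + 1) P)"
    using M_convex_finite[OF 0(1)] 0(4) by (simp add: slice_def card_gt_0_iff)
  ultimately show ?case by (simp add: ext_count_0)
next
  case (Suc m)
  define q where "q = Suc m"
  define A where "A = slice p k P"
  define B where "B = slice p (k + 1) P"
  have pq: "p \<noteq> q" using Suc.prems(2) by (simp add: q_def)
  have A: "M_convex {1..Suc m} A" and B: "M_convex {1..Suc m} B"
    unfolding A_def B_def using Suc.prems(1) by (auto intro: M_convex_slice)
  have ins: "{1..Suc m} = insert q {1..m}" by (auto simp: q_def)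
  have Q: "M_convex (insert p {1..m}) (slice q l P)" for l
    using Suc.prems(1) unfolding ins by (intro M_convex_slice) (simp add: insert_commute)
  obtain a0 where a0: "a0 \<in> A" and topA: "\<And>a. a \<in> A \<Longrightarrow> a q \<le> a0 q"
    using finite_int_max[OF M_convex_finite[OF A], of "\<lambda>a. a q"] Suc.prems(3) A_def by blast
  obtain b0 where b0: "b0 \<in> B" and topB: "\<And>b. b \<in> B \<Longrightarrow> b q \<le> b0 q"
    using finite_int_max[OF M_convex_finite[OF B], of "\<lambda>b. b q"] Suc.prems(4) B_def by blast
  \<comment> \<open>Exchange at \<open>p\<close> lifts a point of the lower slice to the upper one;
    the choice of \<open>b\<close> restricts which coordinate is lowered.\<close>
  have up: "\<exists>j. b j < a j \<and> j \<noteq> p \<and> a + unit_vector p - unit_vector j \<in> B"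
    if "a \<in> A" "b \<in> B" for a b
  proof -
    have "a \<in> P" "b \<in> P" "a p = k" "b p = k + 1"
      using that by (auto simp: A_def B_def slice_iff)
    then obtain j where "b j < a j" "j \<noteq> p" "a + unit_vector p - unit_vector j \<in> P"
      using M_convex_exchange[OF Suc.prems(1), of a b p] by auto
    then show ?thesis
      using \<open>a p = k\<close> by (auto simp: B_def slice_iff unit_vector_apply)
  qed
  \<comment> \<open>Otherwise, exchanging \<open>a0\<close> towards \<open>b0\<close> at
    \<open>q\<close> cannot lower \<open>p\<close>, where \<open>a0\<close> is smaller, so it stays
    in \<open>A\<close> and exceeds the maximum.\<close>
  have le: "b0 q \<le> a0 q"
  proof (rule ccontr)
    assume "\<not> b0 q \<le> a0 q"
    moreover have *: "a0 \<in> P" "b0 \<in> P" "a0 p = k" "b0 p = k + 1"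
      using a0 b0 by (auto simp: A_def B_def slice_iff)
    ultimately obtain j where j: "b0 j < a0 j" "j \<noteq> q" "a0 + unit_vector q - unit_vector j \<in> P"
      using M_convex_exchange[OF Suc.prems(1), of a0 b0 q] by auto
    then have "j \<noteq> p" using * by auto
    then have "a0 + unit_vector q - unit_vector j \<in> A"
      using j * pq by (simp add: A_def slice_iff unit_vector_apply)
    from topA[OF this] j show False by (simp add: unit_vector_apply)
  qed
  \<comment> \<open>Lifting \<open>a0\<close> to \<open>B\<close> lowers \<open>q\<close> by at most
    one.\<close>
  have ge: "a0 q \<le> b0 q + 1"
  proof -
    obtain j where "a0 + unit_vector p - unit_vector j \<in> B" using up[OF a0 b0] by blast
    from topB[OF this] show ?thesis using pq by (auto simp: unit_vector_apply split: if_splits)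
  qed
  \<comment> \<open>Lifting towards \<open>b0\<close> lowers a coordinate where \<open>b0\<close> is
    smaller, so at level \<open>l \<le> b0 q\<close> it preserves \<open>q\<close>. Hence a nonempty
    level of \<open>A\<close> has a nonempty partner in \<open>B\<close>, and the induction
    hypothesis applies to \<open>slice q l P\<close>.\<close>
  have same: "ext_count m (slice q l A) e \<le> ext_count m (slice q l B) e
      + ext_count m (slice q l A) (e - 1)" if "l \<le> b0 q" for l e
  proof (cases "slice q l A = {}")
    case True
    then show ?thesis by (simp add: ext_count_empty ext_count_nonneg)
  next
    case False
    then obtain a where a: "a \<in> A" "a q = l" unfolding slice_def by blast
    obtain j where j: "b0 j < a j" "a + unit_vector p - unit_vector j \<in> B"
      using up[OF a(1) b0] by blast
    have "j \<noteq> q" using j(1) a that by auto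
    then have "a + unit_vector p - unit_vector j \<in> slice q l B"
      using j a pq by (simp add: slice_iff unit_vector_apply)
    then have "slice q l B \<noteq> {}" by blast
    then show ?thesis
      using Suc.IH[OF Q[of l], of k e] Suc.prems(2) False
      unfolding A_def B_def slice_commute[of q l p] by simp
  qed
  obtain l where l: "\<And>a. a \<in> A \<union> B \<Longrightarrow> l \<le> a q" "l \<le> b0 q - 1"
    using finite_int_lower[of "A \<union> B" "\<lambda>a. a q" "b0 q - 1"]
      M_convex_finite[OF A] M_convex_finite[OF B] by blast
  have recA: "ext_count (Suc m) A e = ext_count m (slice q (a0 q) A) e +
      (\<Sum>k\<in>{l..<a0 q}. ext_count m (slice q k A) (e - 1))" for e
    using l(1) topA unfolding q_def by (intro ext_count_Suc[OF A a0]) auto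
  have recB: "ext_count (Suc m) B e = ext_count m (slice q (b0 q) B) e +
      (\<Sum>k\<in>{l..<b0 q}. ext_count m (slice q k B) (e - 1))" for e
    using l(1) topB unfolding q_def by (intro ext_count_Suc[OF B b0]) auto
  have sums: "(\<Sum>k\<in>{l..<b0 q}. ext_count m (slice q k A) (d - 1)) \<le>
      (\<Sum>k\<in>{l..<b0 q}. ext_count m (slice q k B) (d - 1)) +
      (\<Sum>k\<in>{l..<b0 q}. ext_count m (slice q k A) (d - 1 - 1))"
    unfolding sum.distrib[symmetric] by (intro sum_mono same) auto
  have "ext_count (Suc m) A d \<le> ext_count (Suc m) B d + ext_count (Suc m) A (d - 1)"
  proof (cases "a0 q = b0 q")
    case True
    then show ?thesis
      using same[of "b0 q" d] sums unfolding recA recB by simp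
  next
    case False
    then have a0q: "a0 q = b0 q + 1" using le ge by simp
    \<comment> \<open>Maximality of \<open>b0 q\<close> in \<open>B\<close> forces the lowered
      index: going back to \<open>A\<close> by raising \<open>q\<close>, it must be
      \<open>p\<close>; lifting a top point of \<open>A\<close>, it must be
      \<open>q\<close>.\<close>
    have top_eq: "slice q (b0 q) B = (\<lambda>a. a + (unit_vector p - unit_vector q)) ` slice q (a0 q) A"
    proof (intro equalityI subsetI)
      fix b assume b: "b \<in> slice q (b0 q) B"
      have *: "b \<in> P" "b p = k + 1" "b q = b0 q" "a0 \<in> P" "a0 p = k"
        using a0 b by (auto simp: A_def B_def slice_iff)
      then obtain j where j: "j \<noteq> q" "b + unit_vector q - unit_vector j \<in> P"
        using M_convex_exchange[OF Suc.prems(1), of b a0 q] a0q by auto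
      have "j = p"
      proof (rule ccontr)
        assume "j \<noteq> p"
        then have "b + unit_vector q - unit_vector j \<in> B"
          using j * pq by (simp add: B_def slice_iff unit_vector_apply)
        from topB[OF this] show False using j * by (simp add: unit_vector_apply)
      qed
      then have "b + unit_vector q - unit_vector p \<in> slice q (a0 q) A"
        using j * pq a0q by (simp add: A_def slice_iff unit_vector_apply)
      then show "b \<in> (\<lambda>a. a + (unit_vector p - unit_vector q)) ` slice q (a0 q) A"
        by (intro image_eqI[of _ _ "b + unit_vector q - unit_vector p"]) simp_all
    next
      fix b assume "b \<in> (\<lambda>a. a + (unit_vector p - unit_vector q)) ` slice q (a0 q) A"
      then obtain a where a: "a \<in> A" "a q = a0 q"
          and b: "b = a + (unit_vector p - unit_vector q)"
        by (auto simp: slice_iff)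
      obtain j where j: "j \<noteq> p" "a + unit_vector p - unit_vector j \<in> B"
        using up[OF a(1) b0] by blast
      have "j = q"
        using topB[OF j(2)] a a0q pq by (auto simp: unit_vector_apply split: if_splits)
      then have "a + unit_vector p - unit_vector q \<in> slice q (b0 q) B"
        using j a a0q pq by (simp add: slice_iff unit_vector_apply)
      then show "b \<in> slice q (b0 q) B"
        by (simp add: b add_diff_eq)
    qed
    \<comment> \<open>Here \<open>q\<close> plays the role of \<open>p\<close> inside
      \<open>A\<close>, whose two highest levels are compared.\<close>
    have next_top: "ext_count m (slice q (b0 q) A) e \<le> ext_count m (slice q (a0 q) A) e
        + ext_count m (slice q (b0 q) A) (e - 1)" for e
    proof (cases "slice q (b0 q) A = {}")
      case True
      then show ?thesis by (simp add: ext_count_empty ext_count_nonneg)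
    next
      case False
      moreover have "slice q (a0 q) A \<noteq> {}" using a0 by (auto simp: slice_iff)
      ultimately show ?thesis
        using Suc.IH[of q A "b0 q" e] A unfolding ins a0q by (simp add: q_def)
    qed
    have split: "{l..<a0 q} = insert (b0 q) {l..<b0 q}"
      using l(2) a0q by auto
    \<comment> \<open>The top levels cancel by translation. Level \<open>b0 q\<close> of
      \<open>A\<close>, now below the top, enters at \<open>d - 1\<close> and is bounded by the two
      highest levels in the expansion of \<open>ext_count (Suc m) A (d - 1)\<close>.\<close>
    show ?thesis
      using next_top[of "d - 1"] sums
      unfolding recA recB top_eq ext_count_translate split by simp
  qed
  then show ?case by (simp add: A_def B_def)
qed

text \<open>The induction compares slices at equal height; \<open>P'\<close> may stop below the top
  of \<open>P\<close>, and \<open>g\<close> bridges the gap between the two tops.\<close>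

lemma ext_count_mono:
  assumes "M_convex {1..m} P" "M_convex {1..m} P'" "P' \<subseteq> P"
  shows "ext_count m P' d \<le> ext_count m P d"
  using assms
proof (induction m arbitrary: P P' d)
  case 0
  then show ?case
    using M_convex_finite[OF 0(1)] by (simp add: ext_count_0 card_mono)
next
  case (Suc m)
  define q where "q = Suc m"
  have ins: "{1..Suc m} = insert q {1..m}" by (auto simp: q_def)
  show ?case
  proof (cases "P' = {}")
    case True
    then show ?thesis by (simp add: ext_count_empty ext_count_nonneg)
  next
    case False
    obtain z' where z': "z' \<in> P'" and top': "\<And>a. a \<in> P' \<Longrightarrow> a q \<le> z' q"
      using finite_int_max[OF M_convex_finite[OF Suc.prems(2)] False, of "\<lambda>a. a q"] by blast
    obtain z where z: "z \<in> P" and top: "\<And>a. a \<in> P \<Longrightarrow> a q \<le> z q"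
      using finite_int_max[OF M_convex_finite[OF Suc.prems(1)], of "\<lambda>a. a q"] False Suc.prems(3)
      by blast
    obtain l where l: "\<And>a. a \<in> P \<Longrightarrow> l \<le> a q"
      using finite_int_lower[OF M_convex_finite[OF Suc.prems(1)], of "\<lambda>a. a q"] by blast
    have "z' \<in> P" using z' Suc.prems(3) by blast
    \<comment> \<open>For a nonempty level \<open>k\<close>, this is the count of the truncation of
      \<open>P\<close> at height \<open>k\<close>, with level \<open>k\<close> treated as the
      top.\<close>
    define g where "g k = ext_count m (slice q k P) d +
      (\<Sum>i\<in>{l..<k}. ext_count m (slice q i P) (d - 1))" for k
    \<comment> \<open>Raising \<open>k\<close> by one moves level \<open>k\<close> from coefficient
      \<open>d\<close> to \<open>d - 1\<close> and adds level \<open>k + 1\<close> at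
      \<open>d\<close>; the adjacent-slice inequality says exactly that this is no loss.\<close>
    have g_step: "g k \<le> g (k + 1)" if "l \<le> k" "k < z q" for k
    proof -
      have "ext_count m (slice q k P) d \<le> ext_count m (slice q (k + 1) P) d
          + ext_count m (slice q k P) (d - 1)"
      proof (cases "slice q k P = {}")
        case True
        then show ?thesis by (simp add: ext_count_empty ext_count_nonneg)
      next
        case False
        then obtain a where a: "a \<in> P" "a q = k" unfolding slice_def by blast
        \<comment> \<open>Exchange towards \<open>z\<close> shows that the level after a nonempty
          level below the top is nonempty.\<close>
        then have "a q < z q" using that by simp
        then obtain j where "j \<noteq> q" "a + unit_vector q - unit_vector j \<in> P"
          using M_convex_exchange[OF Suc.prems(1) a(1) z] by blast
        then have "a + unit_vector q - unit_vector j \<in> slice q (k + 1) P"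
          using a by (simp add: slice_iff unit_vector_apply)
        then show ?thesis
          using ext_count_adjacent[of q m P k d] Suc.prems(1) False unfolding ins
          by (auto simp: q_def)
      qed
      moreover have "{l..<k + 1} = insert k {l..<k}" using that by auto
      ultimately show ?thesis by (simp add: g_def)
    qed
    have sub: "ext_count m (slice q k P') e \<le> ext_count m (slice q k P) e" for k e
      using Suc.prems unfolding ins
      by (intro Suc.IH M_convex_slice) (auto simp: slice_iff)
    have "ext_count (Suc m) P' d = ext_count m (slice q (z' q) P') d +
        (\<Sum>k\<in>{l..<z' q}. ext_count m (slice q k P') (d - 1))"
      using l top' Suc.prems(3) unfolding q_def by (intro ext_count_Suc[OF Suc.prems(2) z']) auto
    also have "\<dots> \<le> g (z' q)"
      unfolding g_def by (intro add_mono sum_mono sub)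
    also have "\<dots> \<le> g (z q)"
    proof -
      have "k \<le> z q \<longrightarrow> g (z' q) \<le> g k" if "z' q \<le> k" for k
        using that
      proof (induction k rule: int_ge_induct)
        case base
        show ?case by simp
      next
        case (step k)
        then show ?case using g_step[of k] l[OF \<open>z' \<in> P\<close>] by force
      qed
      then show ?thesis using top[OF \<open>z' \<in> P\<close>] by blast
    qed
    also have "\<dots> = ext_count (Suc m) P d"
      using l top unfolding q_def g_def by (intro ext_count_Suc[OF Suc.prems(1) z, symmetric]) auto
    finally show ?thesis .
  qed
qed

section \<open>Polymatroids\<close>

text \<open>Negation swaps internal and external activity, which reduces the interior polynomial to
  the exterior one.\<close>

lemma polymatroid_uminus:
  assumes "polymatroid n P"
  shows "polymatroid n (uminus ` P)"
proof -
  obtain f where f: "f {} = 0" "submodular_on {1..n} f" "P = polymatroid_of n f"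
    using assms by (auto simp: polymatroid_def)
  define E where "E = {1..n}"
  \<comment> \<open>When the total of \<open>a\<close> is \<open>f E\<close>, the sum of
    \<open>- a\<close> over \<open>I\<close> is the sum of \<open>a\<close> over
    \<open>E - I\<close> minus \<open>f E\<close>, so the bound on the complement becomes the bound
    for \<open>- a\<close>.\<close>
  define g where "g I = f (E - I) - f E" for I
  have "g {} = 0" by (simp add: g_def)
  moreover have "submodular_on E g"
    unfolding submodular_on_def
  proof (intro allI impI)
    fix I J assume "I \<subseteq> E" "J \<subseteq> E"
    have "f ((E - I) \<union> (E - J)) + f ((E - I) \<inter> (E - J)) \<le> f (E - I) + f (E - J)"
      using f(2)[folded E_def] by (simp add: submodular_on_def)
    then show "g (I \<union> J) + g (I \<inter> J) \<le> g I + g J"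
      by (simp add: g_def Diff_Un Diff_Int)
  qed
  moreover have "a \<in> P \<longleftrightarrow> - a \<in> polymatroid_of n g" for a
  proof -
    have compl: "(\<Sum>i\<in>E - I. a i) = (\<Sum>i\<in>E. a i) - (\<Sum>i\<in>I. a i)" if "I \<subseteq> E" for I
      using that by (intro sum_diff) (auto simp: E_def)
    have "(\<forall>I. I \<subseteq> E \<longrightarrow> (\<Sum>i\<in>I. a i) \<le> f I) \<longleftrightarrow>
        (\<forall>I. I \<subseteq> E \<longrightarrow> (\<Sum>i\<in>I. (- a) i) \<le> g I)" if "(\<Sum>i\<in>E. a i) = f E"
    proof (intro iffI allI impI)
      fix I assume *: "\<forall>I. I \<subseteq> E \<longrightarrow> (\<Sum>i\<in>I. a i) \<le> f I" "I \<subseteq> E"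
      have "(\<Sum>i\<in>E - I. a i) \<le> f (E - I)" using *(1) by blast
      then show "(\<Sum>i\<in>I. (- a) i) \<le> g I"
        using compl[OF *(2)] that by (simp add: g_def sum_negf)
    next
      fix I assume *: "\<forall>I. I \<subseteq> E \<longrightarrow> (\<Sum>i\<in>I. (- a) i) \<le> g I" "I \<subseteq> E"
      have "(\<Sum>i\<in>E - I. (- a) i) \<le> g (E - I)" using *(1) by blast
      then show "(\<Sum>i\<in>I. a i) \<le> f I"
        using compl[OF *(2)] that *(2) by (simp add: g_def sum_negf double_diff)
    qed
    moreover have "(\<Sum>i\<in>E. a i) = f E \<longleftrightarrow> (\<Sum>i\<in>E. (- a) i) = g E"
      \<comment> \<open>\<open>f {} = 0\<close> yields \<open>g E = - f E\<close>.\<close>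
      using f(1) by (auto simp: g_def sum_negf)
    moreover have "a \<in> lattice_vectors n \<longleftrightarrow> - a \<in> lattice_vectors n"
      by (simp add: lattice_vectors_def)
    ultimately show ?thesis
      unfolding f(3) polymatroid_of_def E_def[symmetric] by blast
  qed
  then have "uminus ` P = polymatroid_of n g"
    by (intro equalityI subsetI) (auto intro: image_eqI[of _ uminus "- _"])
  ultimately show ?thesis
    unfolding polymatroid_def E_def by blast
qed

text \<open>Uncrossing: submodularity and the upper bounds squeeze the union and intersection of two
  tight sets to equality. Intersecting with \<open>E\<close> covers the empty family,
  \<open>E\<close> itself being tight.\<close>

lemma tight_INT:
  assumes f: "submodular_on E f" and le: "\<And>I. I \<subseteq> E \<Longrightarrow> sum a I \<le> f I" and "finite E"
    and "finite K" "sum a E = f E" "\<And>j. j \<in> K \<Longrightarrow> T j \<subseteq> E \<and> sum a (T j) = f (T j)"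
  shows "sum a (E \<inter> (\<Inter>j\<in>K. T j)) = f (E \<inter> (\<Inter>j\<in>K. T j))"
  using assms(4-6)
proof (induction K)
  case empty
  then show ?case by simp
next
  case (insert x K)
  let ?U = "E \<inter> (\<Inter>j\<in>K. T j)"
  have U: "sum a ?U = f ?U" using insert by simp
  have T: "T x \<subseteq> E" "sum a (T x) = f (T x)" using insert.prems by auto
  have "sum a (T x \<union> ?U) + sum a (T x \<inter> ?U) = sum a (T x) + sum a ?U"
    using T(1) \<open>finite E\<close> by (intro sum.union_inter) (auto intro: finite_subset)
  moreover have "f (T x \<union> ?U) + f (T x \<inter> ?U) \<le> f (T x) + f ?U"
    using f T(1) unfolding submodular_on_def by simp
  moreover have "sum a (T x \<union> ?U) \<le> f (T x \<union> ?U)" "sum a (T x \<inter> ?U) \<le> f (T x \<inter> ?U)"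
    using T(1) by (auto intro!: le)
  moreover have "E \<inter> (\<Inter>j\<in>insert x K. T j) = T x \<inter> ?U" by auto
  ultimately show ?case using U T(2) by simp
qed

text \<open>If no exchange at \<open>i\<close> succeeds, each candidate \<open>j\<close> is
  separated from \<open>i\<close> by a set tight for \<open>a\<close>. The intersection of these
  sets is tight, contains \<open>i\<close> and avoids all candidates, so the sum of \<open>b\<close>
  over it exceeds \<open>f\<close>.\<close>

lemma polymatroid_M_convex:
  assumes "polymatroid n P"
  shows "M_convex {1..n} P"
proof -
  obtain f where f: "submodular_on {1..n} f" and P: "P = polymatroid_of n f"
    using assms by (auto simp: polymatroid_def)
  have zero: "a i = 0" if "a \<in> P" "i \<notin> {1..n}" for a i
    using that by (simp add: P polymatroid_of_def lattice_vectors_def)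
  have le: "sum a I \<le> f I" if "a \<in> P" "I \<subseteq> {1..n}" for a I
    using that by (simp add: P polymatroid_of_def)
  have tot: "sum a {1..n} = f {1..n}" if "a \<in> P" for a
    using that by (simp add: P polymatroid_of_def)
  have ex: "\<exists>j. b j < a j \<and> a + unit_vector i - unit_vector j \<in> P"
    if a: "a \<in> P" and b: "b \<in> P" and i: "a i < b i" for a b i
  proof (rule ccontr)
    assume none: "\<not> ?thesis"
    define K where "K = {j \<in> {1..n}. b j < a j}"
    have iE: "i \<in> {1..n}" using zero[OF a, of i] zero[OF b, of i] i by (metis less_irrefl)
    have "\<exists>T. T \<subseteq> {1..n} \<and> sum a T = f T \<and> i \<in> T \<and> j \<notin> T" if "j \<in> K" for j
    proof -
      let ?c = "a + unit_vector i - unit_vector j"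
      have j: "j \<in> {1..n}" "?c \<notin> P" using that none by (auto simp: K_def)
      have c: "sum ?c I = sum a I + (if i \<in> I then 1 else 0) - (if j \<in> I then 1 else 0)"
        if "I \<subseteq> {1..n}" for I
        using finite_subset[OF that]
        by (simp add: unit_vector_def sum.distrib sum_subtractf sum.delta)
      have "?c \<in> lattice_vectors n" "sum ?c {1..n} = f {1..n}"
        using zero[OF a] j iE tot[OF a] c[of "{1..n}"]
        by (auto simp: lattice_vectors_def unit_vector_apply)
      \<comment> \<open>Only a set containing \<open>i\<close> but not \<open>j\<close> gains in
        sum, and it gains one, so by integrality a violated \<open>T\<close> is tight for
        \<open>a\<close>.\<close>
      then obtain T where T: "T \<subseteq> {1..n}" "f T < sum ?c T"
        using j(2) unfolding P polymatroid_of_def mem_Collect_eq by (meson not_le)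
      then show ?thesis
        using c[OF T(1)] le[OF a T(1)] by (intro exI[of _ T]) (auto split: if_splits)
    qed
    then obtain T where T: "\<And>j. j \<in> K \<Longrightarrow>
        T j \<subseteq> {1..n} \<and> sum a (T j) = f (T j) \<and> i \<in> T j \<and> j \<notin> T j"
      by metis
    define U where "U = {1..n} \<inter> (\<Inter>j\<in>K. T j)"
    have "sum a U = f U"
      unfolding U_def
    proof (rule tight_INT[OF f le[OF a]])
      show "finite K" by (simp add: K_def)
      show "sum a {1..n} = f {1..n}" by (rule tot[OF a])
      show "T j \<subseteq> {1..n} \<and> sum a (T j) = f (T j)" if "j \<in> K" for j
        using T[OF that] by blast
    qed simp_all
    moreover have "sum b U \<le> f U" by (intro le[OF b]) (simp add: U_def)
    moreover have "sum a U < sum b U"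
    proof (rule sum_strict_mono_ex1)
      show "\<forall>x\<in>U. a x \<le> b x"
      proof
        fix x assume "x \<in> U"
        then have "x \<notin> K" using T[of x] by (auto simp: U_def)
        then show "a x \<le> b x" using \<open>x \<in> U\<close> by (auto simp: U_def K_def)
      qed
      show "\<exists>x\<in>U. a x < b x"
        using i iE T by (intro bexI[of _ i]) (auto simp: U_def)
    qed (simp add: U_def)
    ultimately show False by simp
  qed
  show ?thesis
    unfolding M_convex_def using finite_polymatroid[OF assms] ex by (simp add: zero)
qed

section \<open>From counts to the two polynomials\<close>

lemma coeff_exterior_poly:
  assumes "finite P"
  shows "coeff (exterior_poly n P) k = ext_count n P (int k)"
proof -
  have "n - card (externally_active n P a) = card (inactive n P a)" for a
  proof -
    have "inactive n P a = {1..n} - externally_active n P a"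
      by (auto simp: inactive_def externally_active_def)
    moreover have "externally_active n P a \<subseteq> {1..n}"
      by (auto simp: externally_active_def)
    ultimately show ?thesis
      by (simp add: card_Diff_subset finite_subset)
  qed
  then show ?thesis
    using assms by (simp add: exterior_poly_def ext_count_def coeff_sum sum.If_cases Int_def)
qed

text \<open>The vector tested for internal activity at \<open>a\<close> is the negative of the one
  tested for external activity at \<open>- a\<close>.\<close>

lemma interior_poly_uminus: "interior_poly n P = exterior_poly n (uminus ` P)"
proof -
  have "- a + unit_vector i - unit_vector j \<in> uminus ` P \<longleftrightarrow>
      a - unit_vector i + unit_vector j \<in> P" for a :: "nat \<Rightarrow> int" and i j
  proof -
    have "- a + unit_vector i - unit_vector j = - (a - unit_vector i + unit_vector j)"
      by simp
    then show ?thesis by (metis (no_types) imageE imageI minus_minus)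
  qed
  then have "externally_active n (uminus ` P) (- a) = internally_active n P a" for a
    by (simp only: externally_active_def internally_active_def)
  then show ?thesis
    by (simp add: interior_poly_def exterior_poly_def sum.reindex inj_on_def)
qed

lemma exterior_poly_mono:
  assumes "polymatroid n P" "polymatroid n P'" "P' \<subseteq> P"
  shows "coeffwise_le (exterior_poly n P') (exterior_poly n P)"
  using ext_count_mono[OF assms(1,2)[THEN polymatroid_M_convex] assms(3)]
  by (simp add: coeffwise_le_def coeff_exterior_poly finite_polymatroid[OF assms(1)]
      finite_polymatroid[OF assms(2)])

theorem theorem4p2:
  fixes n :: nat and P P' :: "(nat \<Rightarrow> int) set"
  assumes "polymatroid n P" and "polymatroid n P'" and "P' \<subseteq> P"
  shows "coeffwise_le (interior_poly n P') (interior_poly n P) \<and>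
         coeffwise_le (exterior_poly n P') (exterior_poly n P)"
  using assms
  by (auto simp: interior_poly_uminus intro!: exterior_poly_mono polymatroid_uminus)

end
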